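(* For every join-tree $A$ over $T_\infty$, \[\Phi_\theta(A)\ \ge\ \tfrac{1}{30}\,\lambda(\langle A\rangle)+\tfrac{2}{5}\,\Delta_\theta(\langle A\rangle).\]
   Context: $T_\infty$ is the infinite tree whose vertex set is partitioned into levels $V_0,V_1,V_2,\dots$ such that each vertex of $V_j$ has exactly one neighbor in $V_{j+1}$ (its parent), each vertex of $V_j$ with $j\ge1$ has exactly two neighbors in $V_{j-1}$ (its children), there are no other edges, and any two vertices have a common ancestor. $V_0$ is the set of leaves. For $x\in V_k$, $T_x$ is the complete binary tree of height $k$ consisting of $x$ and its descendants. Subgraphs have no isolated vertices. For a finite subgraph $F$, $\lambda(F)$ is the maximum $k$ such that some $x\in V_k$ has $T_x\subseteq F$ ($0$ if none). The weighting $\theta:E(T_\infty)\to\mathbb R$ (induced by the uniform random walk) is $\theta(e)=4/3$ if $e$ contains a vertex of $V_0$ and $\theta(e)=2/3$ otherwise; $\Delta_\theta(F)=|V(F)|-\sum_{e\in E(F)}\theta(e)$ for finite $F$. Join-trees: a join-tree over $T_\infty$ is a finite rooted binary tree (each non-leaf node has two ordered children) whose leaves are labeled by elements of $E(T_\infty)\cup\{\bot\}$; its graph $\langle A\rangle$ is the subgraph whose edges are the edge labels occurring in $A$, $V(A)=V(\langle A\rangle)$, and $\Delta_\theta(A)=\Delta_\theta(\langle A\rangle)$. $[\,]$ is the one-node join-tree labeled $\bot$, $[e]$ the one-node join-tree labeled $e$, $[B,C]$ the join-tree whose root has children $B,C$; one-node join-trees are atomic. $D\preceq A$ if $D=[\,]$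 or $D=A$ or $D\preceq$ some child of $A$; $D\prec A$ if $D\preceq A$, $D\ne A$. For a vertex set $S$, $F\ominus S$ is the union of the components of $F$ vertex-disjoint from $S$, and $A\ominus S$ is the join-tree with the same tree as $A$ where a leaf keeps its label iff it is an edge of $\langle A\rangle\ominus S$ (otherwise relabeled $\bot$); for join-trees, $A\ominus(V(C)\cup V(D))$ etc. $\Phi_\theta$ is the pointwise minimal function from join-trees to $\mathbb R_{\ge0}$ satisfying, for all join-trees $A,B,C,D,E$: ($\dagger$) $\Phi_\theta(A)\ge\Phi_\theta(D)+\Delta_\theta(C\ominus V(D))+\Delta_\theta(A\ominus(V(C)\cup V(D)))$ if $A\in\{[B,C],[C,B]\}$ and $D\preceq B$; ($\ddagger$) $\Phi_\theta(A)\ge\frac12\big(\Phi_\theta(D)+\Phi_\theta(E\ominus V(D))+\Delta_\theta(A)+\Delta_\theta(A\ominus(V(D)\cup V(E)))\big)$ if $D,E\prec A$. Equivalently, $\Phi_\theta(A)=\Delta_\theta(A)$ for atomic $A$, and for non-atomic $A$, $\Phi_\theta(A)$ is the maximum of the right-hand sides of all instances of ($\dagger$) and ($\ddagger$). *)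

theory Defs
  imports Complex_Main
begin

section \<open>The tree \<open>T\<^sub>\<infinity>\<close>\<close>

text \<open>
  The conditions on \<open>T\<^sub>\<infinity>\<close> determine it up to isomorphism. We use the following model: the
  vertex \<open>(j, i)\<close> is the \<open>i\<close>-th vertex of level \<open>V\<^sub>j\<close> and its parent is \<open>(j + 1, i div 2)\<close>.
  That the model has the required properties is proved below.
\<close>

type_synonym vertex = "nat \<times> nat"

definition level :: "vertex \<Rightarrow> nat" where
  "level v = fst v"

definition parent :: "vertex \<Rightarrow> vertex" where
  "parent v = (Suc (fst v), snd v div 2)"

text \<open>Edges are two-element vertex sets; \<open>endpoints\<close> is the inclusion map of the edge set.\<close>

typedef edge = "{{v, parent v} | v. True}"
  morphisms endpoints Abs_edge
  by blast

definition adjacent :: "vertex \<Rightarrow> vertex \<Rightarrow> bool" where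
  "adjacent u v \<longleftrightarrow> (\<exists>e. endpoints e = {u, v})"

lemma level_parent [simp]: "level (parent v) = Suc (level v)"
  by (simp add: level_def parent_def)

lemma adjacent_iff: "adjacent u v \<longleftrightarrow> v = parent u \<or> u = parent v"
proof
  assume "adjacent u v"
  then obtain e where e: "endpoints e = {u, v}" unfolding adjacent_def by blast
  obtain x where "endpoints e = {x, parent x}" using endpoints[of e] by blast
  with e show "v = parent u \<or> u = parent v" by (auto simp: doubleton_eq_iff)
next
  have *: "\<exists>e. endpoints e = {x, parent x}" for x
  proof
    show "endpoints (Abs_edge {x, parent x}) = {x, parent x}"
      by (rule Abs_edge_inverse) blast
  qed
  assume "v = parent u \<or> u = parent v"
  then show "adjacent u v"
    unfolding adjacent_def using *[of u] *[of v] by (auto simp: insert_commute)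
qed

lemma adjacent_level: "adjacent u v \<Longrightarrow> level v = Suc (level u) \<or> level u = Suc (level v)"
  by (auto simp: adjacent_iff)

lemma unique_parent: "{u. adjacent v u \<and> level u = Suc (level v)} = {parent v}"
  by (auto simp: adjacent_iff)

lemma two_children:
  assumes "level v = Suc j"
  shows "card {u. adjacent v u \<and> level u = j} = 2"
proof -
  obtain i where v: "v = (Suc j, i)" using assms by (cases v) (auto simp: level_def)
  have "{u. adjacent v u \<and> level u = j} = {(j, 2 * i), (j, 2 * i + 1)}"
    unfolding adjacent_iff level_def parent_def v by auto
  then show ?thesis by simp
qed

lemma funpow_parent: "(parent ^^ n) v = (level v + n, snd v div 2 ^ n)"
  by (induction n) (auto simp: parent_def level_def div_mult2_eq[symmetric] mult.commute)

lemma common_ancestor: "\<exists>m n. (parent ^^ m) u = (parent ^^ n) v"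
proof -
  define N where "N = level u + level v + snd u + snd v"
  have p: "(k::nat) < 2 ^ m" if "k \<le> m" for k m
    using that less_exp[of m] by (rule le_less_trans)
  have "(parent ^^ (N - level u)) u = (N, 0)" "(parent ^^ (N - level v)) v = (N, 0)"
    unfolding funpow_parent by (auto simp: N_def p)
  then show ?thesis by metis
qed

section \<open>Subgraphs\<close>

text \<open>
  Since subgraphs have no isolated vertices, a subgraph of \<open>T\<^sub>\<infinity>\<close> is represented by its edge set.
\<close>

definition verts :: "edge set \<Rightarrow> vertex set" where
  "verts F = (\<Union>e\<in>F. endpoints e)"

definition complete_subtree :: "vertex \<Rightarrow> edge set" where
  "complete_subtree x = {e. \<forall>v\<in>endpoints e. \<exists>n. (parent ^^ n) v = x}"

text \<open>
  If \<open>level x = 0\<close> then \<open>T\<^sub>x\<close> is a single vertex, so that \<open>complete_subtree x = {}\<close> is contained in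
  every \<open>F\<close>; this only contributes the default value \<open>0\<close>.
\<close>

definition lambda_height :: "edge set \<Rightarrow> nat" where
  "lambda_height F = Max {k. k = 0 \<or> (\<exists>x. level x = k \<and> complete_subtree x \<subseteq> F)}"

lemma finite_heights:
  assumes "finite F"
  shows "finite {k. k = 0 \<or> (\<exists>x. level x = k \<and> complete_subtree x \<subseteq> F)}"
proof (rule finite_subset)
  show "finite (insert 0 (level ` verts F))"
  proof -
    have "finite (endpoints e)" for e
      using endpoints[of e] by auto
    then show ?thesis using assms by (auto simp: verts_def)
  qed
  have "level x \<in> level ` verts F" if "complete_subtree x \<subseteq> F" "level x \<noteq> 0" for x
  proof -
    define y where "y = (level x - 1, 2 * snd x)"
    have y: "parent y = x" using that(2) by (cases x) (auto simp: y_def parent_def level_def)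
    have "adjacent y x" by (simp add: adjacent_iff y)
    then obtain e where e: "endpoints e = {y, x}" unfolding adjacent_def by blast
    have "\<exists>n. (parent ^^ n) y = x" "\<exists>n. (parent ^^ n) x = x"
      using y by (auto intro: exI[of _ 1] exI[of _ 0])
    then have "e \<in> complete_subtree x" by (simp add: complete_subtree_def e)
    then have "e \<in> F" using that(1) by blast
    then show ?thesis using e by (auto simp: verts_def)
  qed
  then show "{k. k = 0 \<or> (\<exists>x. level x = k \<and> complete_subtree x \<subseteq> F)} \<subseteq> insert 0 (level ` verts F)"
    by blast
qed

definition \<theta> :: "edge \<Rightarrow> real" where
  "\<theta> e = (if \<exists>v\<in>endpoints e. level v = 0 then 4 / 3 else 2 / 3)"

definition \<Delta> :: "edge set \<Rightarrow> real" where
  "\<Delta> F = real (card (verts F)) - (\<Sum>e\<in>F. \<theta> e)"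

definition component_of :: "edge set \<Rightarrow> vertex \<Rightarrow> edge set" where
  "component_of F v =
     {e \<in> F. \<exists>u\<in>endpoints e. (v, u) \<in> {(x, y). \<exists>d\<in>F. endpoints d = {x, y}}\<^sup>*}"

definition components :: "edge set \<Rightarrow> edge set set" where
  "components F = component_of F ` verts F"

definition graph_ominus :: "edge set \<Rightarrow> vertex set \<Rightarrow> edge set" where
  "graph_ominus F S = \<Union>{K \<in> components F. verts K \<inter> S = {}}"

section \<open>Join-trees\<close>

text \<open>
  \<open>Atom None\<close> is the one-node join-tree labelled \<open>\<bottom>\<close>. The set function \<open>graph\<close> generated by the
  datatype package collects the edge labels, so \<open>graph A\<close> is \<open>\<langle>A\<rangle>\<close>.
\<close>

datatype (graph: 'e) join_tree =
  Atom "'e option"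
| Join "'e join_tree" "'e join_tree"

definition jverts :: "edge join_tree \<Rightarrow> vertex set" where
  "jverts A = verts (graph A)"

definition j\<Delta> :: "edge join_tree \<Rightarrow> real" where
  "j\<Delta> A = \<Delta> (graph A)"

primrec sub_join_tree :: "'e join_tree \<Rightarrow> 'e join_tree \<Rightarrow> bool" (infix "\<preceq>\<^sub>J" 50) where
  "D \<preceq>\<^sub>J Atom l \<longleftrightarrow> D = Atom None \<or> D = Atom l"
| "D \<preceq>\<^sub>J Join B C \<longleftrightarrow> D = Atom None \<or> D = Join B C \<or> D \<preceq>\<^sub>J B \<or> D \<preceq>\<^sub>J C"

definition strict_sub_join_tree :: "'e join_tree \<Rightarrow> 'e join_tree \<Rightarrow> bool" (infix "\<prec>\<^sub>J" 50) where
  "D \<prec>\<^sub>J A \<longleftrightarrow> D \<preceq>\<^sub>J A \<and> D \<noteq> A"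

primrec restrict_labels :: "'e set \<Rightarrow> 'e join_tree \<Rightarrow> 'e join_tree" where
  "restrict_labels K (Atom l) =
     Atom (case l of None \<Rightarrow> None | Some e \<Rightarrow> if e \<in> K then Some e else None)"
| "restrict_labels K (Join B C) = Join (restrict_labels K B) (restrict_labels K C)"

definition jominus :: "edge join_tree \<Rightarrow> vertex set \<Rightarrow> edge join_tree" (infixl "\<ominus>\<^sub>J" 65) where
  "A \<ominus>\<^sub>J S = restrict_labels (graph_ominus (graph A) S) A"

section \<open>The potential \<open>\<Phi>\<^sub>\<theta>\<close>\<close>

definition dagger :: "(edge join_tree \<Rightarrow> real) \<Rightarrow> bool" where
  "dagger f \<longleftrightarrow> (\<forall>A B C D. A \<in> {Join B C, Join C B} \<and> D \<preceq>\<^sub>J B \<longrightarrow>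
     f A \<ge> f D + j\<Delta> (C \<ominus>\<^sub>J jverts D) + j\<Delta> (A \<ominus>\<^sub>J (jverts C \<union> jverts D)))"

definition ddagger :: "(edge join_tree \<Rightarrow> real) \<Rightarrow> bool" where
  "ddagger f \<longleftrightarrow> (\<forall>A D E. D \<prec>\<^sub>J A \<and> E \<prec>\<^sub>J A \<longrightarrow>
     f A \<ge> 1 / 2 * (f D + f (E \<ominus>\<^sub>J jverts D) + j\<Delta> A + j\<Delta> (A \<ominus>\<^sub>J (jverts D \<union> jverts E))))"

definition admissible :: "(edge join_tree \<Rightarrow> real) \<Rightarrow> bool" where
  "admissible f \<longleftrightarrow> (\<forall>A. 0 \<le> f A) \<and> dagger f \<and> ddagger f"

text \<open>
  The least element is taken with respect to the pointwise order on functions; the lemmas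
  \<open>admissible_\<Phi>\<close> and \<open>\<Phi>_least\<close> below show that it exists.
\<close>

definition \<Phi> :: "edge join_tree \<Rightarrow> real" where
  "\<Phi> = (LEAST f. admissible f)"

primrec leaves :: "'e join_tree \<Rightarrow> nat" where
  "leaves (Atom l) = 1"
| "leaves (Join B C) = leaves B + leaves C"

lemma leaves_pos: "1 \<le> leaves A"
  by (induction A) auto

lemma leaves_restrict [simp]: "leaves (restrict_labels K A) = leaves A"
  by (induction A) auto

lemma leaves_jominus [simp]: "leaves (A \<ominus>\<^sub>J S) = leaves A"
  by (simp add: jominus_def)

lemma leaves_sub: "D \<preceq>\<^sub>J A \<Longrightarrow> leaves D \<le> leaves A"
proof (induction A)
  case (Join B C)
  then show ?case using leaves_pos[of B] leaves_pos[of C] by fastforce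
qed auto

lemma finite_graph: "finite (graph A)"
proof (induction A)
  case (Atom l)
  then show ?case by (cases l) auto
qed auto

lemma card_graph: "card (graph A) \<le> leaves A"
proof (induction A)
  case (Atom l)
  then show ?case by (cases l) auto
next
  case (Join B C)
  then show ?case using card_Un_le[of "graph B" "graph C"] by simp
qed

lemma card_endpoints: "card (endpoints e) \<le> 2"
proof -
  obtain x where "endpoints e = {x, parent x}" using endpoints[of e] by blast
  then show ?thesis by (simp add: card_insert_if)
qed

lemma j\<Delta>_le: "j\<Delta> A \<le> 2 * real (leaves A)"
proof -
  have "card (verts (graph A)) \<le> (\<Sum>e\<in>graph A. card (endpoints e))"
    unfolding verts_def by (rule card_UN_le[OF finite_graph])
  also have "\<dots> \<le> (\<Sum>e\<in>graph A. 2)"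
    by (rule sum_mono) (rule card_endpoints)
  also have "\<dots> \<le> 2 * leaves A" using card_graph[of A] by simp
  finally have "real (card (verts (graph A))) \<le> 2 * real (leaves A)" by linarith
  moreover have "0 \<le> (\<Sum>e\<in>graph A. \<theta> e)"
    by (rule sum_nonneg) (simp add: \<theta>_def)
  ultimately show ?thesis by (simp add: j\<Delta>_def \<Delta>_def)
qed

lemma admissible_exists: "\<exists>f. admissible f"
proof
  define f :: "edge join_tree \<Rightarrow> real" where
    "f = (\<lambda>A. if A = Atom None then 0 else 4 * real (leaves A) ^ 2)"
  have f_le: "f D \<le> 4 * (real n - 1) ^ 2" if "Suc (leaves D) \<le> n" for D n
  proof -
    have "real (leaves D) \<le> real n - 1" using that by linarith
    then have "real (leaves D) ^ 2 \<le> (real n - 1) ^ 2" by (intro power_mono) auto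
    then show ?thesis by (simp add: f_def)
  qed
  have step: "4 * (real n - 1) ^ 2 + 4 * real n \<le> 4 * real n ^ 2" if "1 \<le> n" for n :: nat
    using that by (simp add: power2_eq_square algebra_simps)
  have "dagger f"
    unfolding dagger_def
  proof (intro allI impI, elim conjE)
    fix A B C D :: "edge join_tree"
    assume A: "A \<in> {Join B C, Join C B}" and D: "D \<preceq>\<^sub>J B"
    have fA: "f A = 4 * real (leaves A) ^ 2" using A by (auto simp: f_def)
    have lA: "leaves A = leaves B + leaves C" using A by auto
    have lD: "leaves D \<le> leaves B" using leaves_sub[OF D] .
    have "f D \<le> 4 * real (leaves B) ^ 2"
      using lD by (auto simp: f_def intro!: power_mono)
    moreover have "2 * real (leaves C) + 2 * real (leaves A) + 4 * real (leaves B) ^ 2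
        \<le> 4 * real (leaves A) ^ 2"
    proof -
      define b c where "b = real (leaves B)" and "c = real (leaves C)"
      have "1 \<le> b" "1 \<le> c" unfolding b_def c_def using leaves_pos[of B] leaves_pos[of C] by auto
      then have "b \<le> b * c" "c \<le> c * c" using mult_left_mono[of 1 c b] mult_left_mono[of 1 c c] by auto
      then have "2 * c + 2 * (b + c) + 4 * b ^ 2 \<le> 4 * (b + c) ^ 2"
        unfolding power2_eq_square distrib_left distrib_right mult.commute[of c b]
        using \<open>1 \<le> b\<close> \<open>1 \<le> c\<close> by linarith
      then show ?thesis by (simp add: b_def c_def lA)
    qed
    ultimately show "f D + j\<Delta> (C \<ominus>\<^sub>J jverts D) + j\<Delta> (A \<ominus>\<^sub>J (jverts C \<union> jverts D)) \<le> f A"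
      using j\<Delta>_le[of "C \<ominus>\<^sub>J jverts D"] j\<Delta>_le[of "A \<ominus>\<^sub>J (jverts C \<union> jverts D)"] fA
      by simp
  qed
  moreover have "ddagger f"
    unfolding ddagger_def
  proof (intro allI impI, elim conjE)
    fix A D E :: "edge join_tree"
    assume D: "D \<prec>\<^sub>J A" and E: "E \<prec>\<^sub>J A"
    have fA: "f A = 4 * real (leaves A) ^ 2"
      using D by (auto simp: f_def strict_sub_join_tree_def)
    have X: "f X \<le> 4 * (real (leaves A) - 1) ^ 2"
      if "X = G \<ominus>\<^sub>J S \<or> X = G" "G \<prec>\<^sub>J A" for X G S
    proof (cases A)
      case (Atom l)
      then have "G = Atom None" using that by (auto simp: strict_sub_join_tree_def)
      then have "X = Atom None" using that by (auto simp: jominus_def)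
      then show ?thesis by (simp add: f_def)
    next
      case (Join B C)
      then have "Suc (leaves G) \<le> leaves A"
        using that(2) leaves_pos[of B] leaves_pos[of C] leaves_sub[of G B] leaves_sub[of G C]
        by (auto simp: strict_sub_join_tree_def)
      then show ?thesis using that(1) by (auto intro!: f_le)
    qed
    show "1 / 2 * (f D + f (E \<ominus>\<^sub>J jverts D) + j\<Delta> A + j\<Delta> (A \<ominus>\<^sub>J (jverts D \<union> jverts E))) \<le> f A"
      using X[of D D] X[of "E \<ominus>\<^sub>J jverts D" E "jverts D"] D E fA
        j\<Delta>_le[of A] j\<Delta>_le[of "A \<ominus>\<^sub>J (jverts D \<union> jverts E)"] step[OF leaves_pos[of A]]
        zero_le_power2[of "real (leaves A)"]
      by (simp add: field_simps)
  qed
  ultimately show "admissible f" by (simp add: admissible_def f_def)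
qed

lemma least_admissible: "\<exists>f. admissible f \<and> (\<forall>g. admissible g \<longrightarrow> f \<le> g)"
proof -
  define h where "h = (\<lambda>A. INF g\<in>Collect admissible. g A)"
  have ne: "Collect admissible \<noteq> {}" using admissible_exists by blast
  have lower: "h A \<le> g A" if "admissible g" for g A
    unfolding h_def
    by (rule cINF_lower) (use that in \<open>auto simp: bdd_below_def admissible_def intro!: exI[of _ 0]\<close>)
  have greatest: "c \<le> h A" if "\<And>g. admissible g \<Longrightarrow> c \<le> g A" for c A
    unfolding h_def by (rule cINF_greatest[OF ne]) (use that in auto)
  have "dagger h"
    unfolding dagger_def
  proof (intro allI impI)
    fix A B C D :: "edge join_tree"
    assume H: "A \<in> {Join B C, Join C B} \<and> D \<preceq>\<^sub>J B"
    show "h D + j\<Delta> (C \<ominus>\<^sub>J jverts D) + j\<Delta> (A \<ominus>\<^sub>J (jverts C \<union> jverts D)) \<le> h A"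
    proof (rule greatest)
      fix g assume g: "admissible g"
      then have "g D + j\<Delta> (C \<ominus>\<^sub>J jverts D) + j\<Delta> (A \<ominus>\<^sub>J (jverts C \<union> jverts D)) \<le> g A"
        using H unfolding admissible_def dagger_def by blast
      with lower[OF g, of D]
      show "h D + j\<Delta> (C \<ominus>\<^sub>J jverts D) + j\<Delta> (A \<ominus>\<^sub>J (jverts C \<union> jverts D)) \<le> g A"
        by linarith
    qed
  qed
  moreover have "ddagger h"
    unfolding ddagger_def
  proof (intro allI impI)
    fix A D E :: "edge join_tree"
    assume H: "D \<prec>\<^sub>J A \<and> E \<prec>\<^sub>J A"
    show "1 / 2 * (h D + h (E \<ominus>\<^sub>J jverts D) + j\<Delta> A + j\<Delta> (A \<ominus>\<^sub>J (jverts D \<union> jverts E))) \<le> h A"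
    proof (rule greatest)
      fix g assume g: "admissible g"
      then have "1 / 2 * (g D + g (E \<ominus>\<^sub>J jverts D) + j\<Delta> A
          + j\<Delta> (A \<ominus>\<^sub>J (jverts D \<union> jverts E))) \<le> g A"
        using H unfolding admissible_def ddagger_def by blast
      with lower[OF g, of D] lower[OF g, of "E \<ominus>\<^sub>J jverts D"]
      show "1 / 2 * (h D + h (E \<ominus>\<^sub>J jverts D) + j\<Delta> A
          + j\<Delta> (A \<ominus>\<^sub>J (jverts D \<union> jverts E))) \<le> g A"
        by argo
    qed
  qed
  moreover have "\<forall>A. 0 \<le> h A"
    by (intro allI greatest) (simp add: admissible_def)
  ultimately have "admissible h" by (simp add: admissible_def)
  then show ?thesis using lower by (auto simp: le_fun_def)
qed

lemma admissible_\<Phi>: "admissible \<Phi>"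
  and \<Phi>_least: "admissible g \<Longrightarrow> \<Phi> \<le> g"
proof -
  obtain f where f: "admissible f" "\<And>g. admissible g \<Longrightarrow> f \<le> g"
    using least_admissible by blast
  then have "\<Phi> = f" unfolding \<Phi>_def by (intro Least_equality) auto
  with f show "admissible \<Phi>" "admissible g \<Longrightarrow> \<Phi> \<le> g" by auto
qed

end

theory Submission
  imports Defs
begin

text \<open>
  Let \<open>b(F)\<close> be the number of pairs of a vertex of \<open>F\<close> and an incident edge outside \<open>F\<close>. Then
  \<open>\<Delta> F = b(F) / 3\<close>, so the claim is \<open>\<lambda>(F) + 4 b(F) \<le> 30 \<Phi> A\<close> for \<open>F = \<langle>A\<rangle>\<close>. In a counterexample \<open>A\<close>
  with the fewest leaves, put \<open>k = \<lambda>\<close> and \<open>b = b(\<langle>A\<rangle>)\<close>, and let \<open>T\<^sub>x \<subseteq> \<langle>A\<rangle>\<close> with \<open>x\<close> at level \<open>k\<close>.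
  Since \<open>\<Phi> \<ge> \<Delta>\<close>, we have \<open>k > 6b\<close>; since \<open>\<Phi>\<close> is monotone, \<open>\<lambda>(D) + 4 b(D) < k + 4b\<close> for all
  \<open>D \<prec> A\<close>.

  For suitable \<open>a\<close> (logarithmic in \<open>b\<close>) some \<open>D \<prec> A\<close> contains a complete subtree of height \<open>l = k - a\<close>
  but so few of those below \<open>x\<close> that, its boundary being small, it is disjoint from one of them,
  \<open>T\<^sub>z\<close>. For suitable \<open>h\<close> (about \<open>2b\<close>) let \<open>E\<close> be minimal such that \<open>T\<^sub>w \<subseteq> E\<close> for some \<open>w\<close> below
  \<open>z\<close> at level \<open>q = l - h\<close>. If the path from \<open>w\<close> to \<open>z\<close> leaves \<open>E\<close>, then \<open>T\<^sub>w\<close> survives in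
  \<open>E \<ominus> V(D)\<close>, and \<open>(\<ddagger>)\<close> for \<open>D\<close>, \<open>E\<close> gives a contradiction. Otherwise the trees hanging off the path
  make \<open>b(E)\<close> large unless \<open>E\<close> contains a high \<open>T\<^sub>u\<close> below \<open>z\<close>; by minimality of \<open>E\<close> none of the
  many complete subtrees of \<open>T\<^sub>u\<close> of height \<open>q\<close> lies in a child of \<open>E\<close>, and then a child of \<open>E\<close>
  has too large a boundary relative to its height.
\<close>

section \<open>Descendants and edges\<close>

definition desc :: "vertex \<Rightarrow> vertex \<Rightarrow> bool" where
  "desc v x \<longleftrightarrow> (\<exists>n. (parent ^^ n) v = x)"

definition up :: "vertex \<Rightarrow> edge" where
  "up v = Abs_edge {v, parent v}"

lemma endpoints_up [simp]: "endpoints (up v) = {v, parent v}"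
  unfolding up_def by (rule Abs_edge_inverse) blast

lemma edge_cases: obtains v where "e = up v"
proof -
  obtain v where "endpoints e = {v, parent v}" using endpoints[of e] by blast
  then have "endpoints e = endpoints (up v)" by simp
  then show ?thesis using that by (metis endpoints_inject)
qed

lemma up_inject [simp]: "up u = up v \<longleftrightarrow> u = v"
proof
  assume "up u = up v"
  then have "{u, parent u} = {v, parent v}" by (metis endpoints_up)
  then have "u = v \<or> u = parent v \<and> parent u = v" by (auto simp: doubleton_eq_iff)
  moreover have "\<not> (u = parent v \<and> parent u = v)"
    by (metis level_parent less_not_sym lessI)
  ultimately show "u = v" by blast
qed simp

lemma desc_refl [simp]: "desc v v"
  unfolding desc_def by (rule exI[of _ 0]) simp

lemma desc_parent: "desc (parent v) x \<Longrightarrow> desc v x"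
  unfolding desc_def by (metis funpow_Suc_right o_apply)

lemma desc_parent_self [simp]: "desc v (parent v)"
  by (rule desc_parent) simp

lemma desc_cases: "desc v x \<Longrightarrow> v = x \<or> desc (parent v) x"
  unfolding desc_def by (metis funpow_0 funpow_Suc_right o_apply not0_implies_Suc)

lemma desc_trans: "desc u v \<Longrightarrow> desc v w \<Longrightarrow> desc u w"
  unfolding desc_def by (metis funpow_add o_apply)

lemma desc_funpow [simp]: "desc v ((parent ^^ n) v)"
  unfolding desc_def by blast

lemma level_funpow [simp]: "level ((parent ^^ n) v) = level v + n"
  by (induction n) auto

lemma desc_level: "desc v x \<Longrightarrow> level v \<le> level x"
  unfolding desc_def by auto

lemma desc_iff: "desc v x \<longleftrightarrow> level v \<le> level x \<and> snd v div 2 ^ (level x - level v) = snd x"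
proof
  assume "desc v x"
  then obtain n where "(parent ^^ n) v = x" unfolding desc_def by blast
  then show "level v \<le> level x \<and> snd v div 2 ^ (level x - level v) = snd x"
    unfolding funpow_parent by (auto simp: level_def)
next
  assume *: "level v \<le> level x \<and> snd v div 2 ^ (level x - level v) = snd x"
  have "(parent ^^ (level x - level v)) v = x"
    unfolding funpow_parent using * by (simp add: level_def prod_eq_iff)
  then show "desc v x" unfolding desc_def by blast
qed

lemma desc_unique: "desc v x \<Longrightarrow> desc v y \<Longrightarrow> level x = level y \<Longrightarrow> x = y"
  by (auto simp: desc_iff level_def prod_eq_iff)

lemma desc_funpow_level: "desc v x \<Longrightarrow> level x = level v + n \<Longrightarrow> (parent ^^ n) v = x"
  by (metis desc_funpow desc_unique level_funpow)

definition descs :: "vertex \<Rightarrow> nat \<Rightarrow> vertex set" where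
  "descs x l = {w. level w = l \<and> desc w x}"

text \<open>The second coordinates of these descendants fill an interval of length
  \<open>2 ^ (level x - l)\<close>.\<close>

lemma card_descs:
  assumes "l \<le> level x"
  shows "card (descs x l) = 2 ^ (level x - l)"
proof -
  define p :: nat where "p = 2 ^ (level x - l)"
  have p: "p > 0" by (simp add: p_def)
  have "i div p = s \<longleftrightarrow> i \<in> {s * p ..< s * p + p}" for i s
    using less_eq_div_iff_mult_less_eq[OF p, of s i] div_less_iff_less_mult[OF p, of i "Suc s"]
    by (auto simp: add.commute)
  then have "descs x l = Pair l ` {snd x * p ..< snd x * p + p}"
    using assms by (force simp: descs_def desc_iff level_def p_def)
  then show ?thesis by (simp add: card_image inj_on_def p_def)
qed

lemma finite_descs: "l \<le> level x \<Longrightarrow> finite (descs x l)"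
  using card_descs[of l x] by (metis card.infinite power_not_zero zero_neq_numeral)

lemma up_in_subtree: "up v \<in> complete_subtree x \<longleftrightarrow> desc (parent v) x"
  unfolding complete_subtree_def by (auto simp: desc_def[symmetric] intro: desc_parent)

lemma subtree_mono: "desc v x \<Longrightarrow> complete_subtree v \<subseteq> complete_subtree x"
  by (auto simp: complete_subtree_def desc_def[symmetric] intro: desc_trans)

lemma subtree_disjoint:
  "e \<in> complete_subtree x \<Longrightarrow> e \<in> complete_subtree y \<Longrightarrow> level x = level y \<Longrightarrow> x = y"
  by (cases e rule: edge_cases) (auto simp: up_in_subtree intro: desc_unique)

definition sib :: "vertex \<Rightarrow> vertex" where
  "sib v = (fst v, if even (snd v) then Suc (snd v) else snd v - 1)"

lemma parent_sib [simp]: "parent (sib v) = parent v"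
  by (auto simp: sib_def parent_def elim: oddE)

lemma level_sib [simp]: "level (sib v) = level v"
  by (simp add: sib_def level_def)

lemma sib_neq: "sib v \<noteq> v"
  by (cases v) (auto simp: sib_def elim: oddE)

lemma parent_eq_iff: "parent u = parent v \<longleftrightarrow> u = v \<or> u = sib v"
proof
  assume "parent u = parent v"
  then have "fst u = fst v" "snd u div 2 = snd v div 2" by (auto simp: parent_def)
  then have "fst u = fst v" "snd u = snd v \<or> snd u = (if even (snd v) then Suc (snd v) else snd v - 1)"
    by presburger+
  then show "u = v \<or> u = sib v" by (auto simp: sib_def prod_eq_iff)
qed auto

lemma exists_child:
  assumes "1 \<le> level x"
  obtains y where "parent y = x"
  using assms that[of "(level x - 1, 2 * snd x)"] by (auto simp: parent_def level_def prod_eq_iff)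

lemma desc_parent_iff: "desc v (parent w) \<longleftrightarrow> v = parent w \<or> desc v w \<or> desc v (sib w)"
proof
  assume "desc v (parent w)"
  then obtain n where n: "(parent ^^ n) v = parent w" unfolding desc_def by blast
  show "v = parent w \<or> desc v w \<or> desc v (sib w)"
  proof (cases n)
    case (Suc m)
    then have "parent ((parent ^^ m) v) = parent w" using n by simp
    then show ?thesis unfolding parent_eq_iff by (auto simp: desc_def)
  qed (use n in simp)
next
  have "desc (sib w) (parent w)" by (metis desc_parent_self parent_sib)
  then show "v = parent w \<or> desc v w \<or> desc v (sib w) \<Longrightarrow> desc v (parent w)"
    by (auto intro: desc_trans)
qed

lemma subtree_parent:
  "complete_subtree (parent w) =
     insert (up w) (complete_subtree w) \<union> insert (up (sib w)) (complete_subtree (sib w))"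
proof (intro set_eqI)
  fix e
  obtain v where e: "e = up v" by (rule edge_cases)
  show "e \<in> complete_subtree (parent w) \<longleftrightarrow>
    e \<in> insert (up w) (complete_subtree w) \<union> insert (up (sib w)) (complete_subtree (sib w))"
    unfolding e by (auto simp: up_in_subtree desc_parent_iff parent_eq_iff)
qed

section \<open>The boundary\<close>

definition bd :: "edge set \<Rightarrow> (vertex \<times> edge) set" where
  "bd F = {(v, e). v \<in> verts F \<and> v \<in> endpoints e \<and> e \<notin> F}"

definition inc :: "vertex \<Rightarrow> edge set" where
  "inc v = {e. v \<in> endpoints e}"

lemma inc_leaf: "level v = 0 \<Longrightarrow> inc v = {up v}"
proof (intro set_eqI)
  fix e assume v: "level v = 0"
  obtain u where e: "e = up u" by (rule edge_cases)
  show "e \<in> inc v \<longleftrightarrow> e \<in> {up v}" using v unfolding e inc_def by auto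
qed

lemma inc_inner: "inc (parent w) = {up (parent w), up w, up (sib w)}"
proof (intro set_eqI)
  fix e
  obtain u where e: "e = up u" by (rule edge_cases)
  show "e \<in> inc (parent w) \<longleftrightarrow> e \<in> {up (parent w), up w, up (sib w)}"
    unfolding e inc_def using parent_eq_iff[of u w] by auto
qed

lemma card_inc: "card (inc v) = (if level v = 0 then 1 else 3)"
proof (cases "level v = 0")
  case False
  then obtain w where w: "parent w = v" using exists_child[of v] by auto
  have "w \<noteq> parent w" "sib w \<noteq> parent w" "w \<noteq> sib w"
    using level_parent[of w] level_sib[of w] sib_neq[of w] by (metis n_not_Suc_n)+
  then show ?thesis using False inc_inner[of w] unfolding w by auto
qed (simp add: inc_leaf)

lemma finite_inc: "finite (inc v)"
  using card_inc[of v] by (metis card.infinite zero_neq_numeral zero_neq_one)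

lemma finite_verts: "finite F \<Longrightarrow> finite (verts F)"
  unfolding verts_def using edge_cases by (metis endpoints_up finite.emptyI finite_UN_I finite_insert)

lemma bd_Sigma: "bd F = (SIGMA v:verts F. inc v - F)"
  by (auto simp: bd_def inc_def)

lemma finite_bd: "finite F \<Longrightarrow> finite (bd F)"
  unfolding bd_Sigma by (intro finite_SigmaI finite_verts finite_Diff finite_inc)

text \<open>
  The weighting \<open>\<theta>\<close> of an edge is the sum of the reciprocals of the degrees of its endpoints, and
  leaves of \<open>T\<^sub>\<infinity>\<close> have no missing edges.
\<close>

lemma \<Delta>_eq_bd:
  assumes F: "finite F"
  shows "\<Delta> F = real (card (bd F)) / 3"
proof -
  have \<theta>: "\<theta> e = (\<Sum>v\<in>{v \<in> verts F. v \<in> endpoints e}. 1 / real (card (inc v)))" if "e \<in> F" for e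
  proof -
    obtain w where e: "e = up w" by (rule edge_cases)
    have "{v \<in> verts F. v \<in> endpoints e} = {w, parent w}"
      using that unfolding verts_def e by force
    moreover have "w \<noteq> parent w" using level_parent[of w] by (metis n_not_Suc_n)
    ultimately show ?thesis unfolding \<theta>_def card_inc e by simp
  qed
  have "(\<Sum>e\<in>F. \<theta> e) = (\<Sum>e\<in>F. \<Sum>v\<in>{v \<in> verts F. v \<in> endpoints e}. 1 / real (card (inc v)))"
    using \<theta> by (rule sum.cong[OF refl])
  also have "\<dots> = (\<Sum>v\<in>verts F. \<Sum>e\<in>{e \<in> F. v \<in> endpoints e}. 1 / real (card (inc v)))"
    by (rule sum.swap_restrict[OF F finite_verts[OF F]])
  also have "\<dots> = (\<Sum>v\<in>verts F. real (card (inc v \<inter> F)) / real (card (inc v)))"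
    by (rule sum.cong) (auto simp: inc_def Int_def conj_commute)
  finally have "\<Delta> F = (\<Sum>v\<in>verts F. 1 - real (card (inc v \<inter> F)) / real (card (inc v)))"
    unfolding \<Delta>_def by (simp add: sum_subtractf)
  also have "\<dots> = (\<Sum>v\<in>verts F. real (card (inc v - F)) / 3)"
  proof (rule sum.cong[OF refl])
    fix v assume v: "v \<in> verts F"
    have *: "card (inc v \<inter> F) + card (inc v - F) = card (inc v)"
      using card_Int_Diff[OF finite_inc] by simp
    show "1 - real (card (inc v \<inter> F)) / real (card (inc v)) = real (card (inc v - F)) / 3"
    \<comment> \<open>A level-0 vertex of \<open>F\<close> has its only edge in \<open>F\<close>, so
      both sides vanish; elsewhere the degree is 3 and each missing edge counts 1/3.\<close>
    proof (cases "level v = 0")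
      case True
      obtain e where "e \<in> F" "v \<in> endpoints e" using v unfolding verts_def by blast
      then have "e \<in> inc v" by (simp add: inc_def)
      then have "inc v \<subseteq> F" using inc_leaf[OF True] \<open>e \<in> F\<close> by simp
      then have "card (inc v - F) = 0" by (metis Diff_eq_empty_iff card.empty)
      then show ?thesis using * card_inc[of v] True by simp
    next
      case False
      then have "card (inc v) = 3" by (simp add: card_inc)
      then show ?thesis using * by (simp add: field_simps)
    qed
  qed
  also have "\<dots> = real (card (bd F)) / 3"
    unfolding bd_Sigma using finite_inc finite_verts[OF F]
    by (subst card_SigmaI) (auto simp: sum_divide_distrib)
  finally show ?thesis .
qed

lemma \<Delta>_nonneg: "finite F \<Longrightarrow> 0 \<le> \<Delta> F"
  by (simp add: \<Delta>_eq_bd)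

lemma up_verts: "up v \<in> F \<Longrightarrow> v \<in> verts F \<and> parent v \<in> verts F"
  unfolding verts_def by (metis UN_I endpoints_up insertCI)

text \<open>At a vertex of maximal level the parent edge must be missing.\<close>

lemma bd_top:
  assumes "finite F" "F \<noteq> {}"
  obtains v where "(v, up v) \<in> bd F" "\<And>u. u \<in> verts F \<Longrightarrow> level u \<le> level v"
proof -
  have "verts F \<noteq> {}" using assms(2) edge_cases up_verts by (metis all_not_in_conv)
  then have "Max (level ` verts F) \<in> level ` verts F"
    using finite_verts[OF assms(1)] by (intro Max_in) auto
  then obtain v where v: "v \<in> verts F" "level v = Max (level ` verts F)" by auto
  then have max: "level u \<le> level v" if "u \<in> verts F" for u
    using that finite_verts[OF assms(1)] by simp
  have "up v \<notin> F" using up_verts[of v F] max[of "parent v"] by auto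
  with v(1) max that show ?thesis by (auto simp: bd_def)
qed

text \<open>Descending from \<open>x\<close>, the first edge missing from \<open>F\<close> would
  form a boundary pair inside the subtree.\<close>

lemma subtree_closed:
  assumes "x \<in> verts F" and "\<And>v e. (v, e) \<in> bd F \<Longrightarrow> e \<notin> complete_subtree x"
  shows "complete_subtree x \<subseteq> F"
proof -
  have "desc v x \<Longrightarrow> v \<in> verts F" if "level v + n = level x" for v n
    using that
  proof (induction n arbitrary: v)
    case 0
    then show ?case using desc_unique[of v v x] assms(1) by auto
  next
    case (Suc n)
    then have p: "desc (parent v) x" using desc_cases[of v x] by auto
    with Suc have "parent v \<in> verts F" by auto
    then have "up v \<in> F" using assms(2)[of "parent v" "up v"] p by (auto simp: bd_def up_in_subtree)
    then show ?case using up_verts by blast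
  qed
  then have *: "v \<in> verts F" if "desc v x" for v using that desc_level[OF that] le_Suc_ex by metis
  show ?thesis
  proof
    fix e assume e: "e \<in> complete_subtree x"
    obtain v where v: "e = up v" by (rule edge_cases)
    then have "parent v \<in> verts F" using * e by (simp add: up_in_subtree)
    then show "e \<in> F" using assms(2)[of "parent v" e] e by (auto simp: bd_def v)
  qed
qed

text \<open>Without such a pair one climbs inside \<open>F\<close> from \<open>e\<close> up to
  \<open>x\<close>, and \<open>subtree_closed\<close> then fills the whole subtree.\<close>

lemma bd_in_subtree:
  assumes "e \<in> F" "e \<in> complete_subtree x" "\<not> complete_subtree x \<subseteq> F"
  shows "\<exists>p\<in>bd F. snd p \<in> complete_subtree x"
proof (rule ccontr)
  assume no: "\<not> ?thesis"
  then have no: "\<And>v e. (v, e) \<in> bd F \<Longrightarrow> e \<notin> complete_subtree x" by force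
  have "v \<in> verts F \<Longrightarrow> desc v x \<Longrightarrow> x \<in> verts F" if "level v + n = level x" for v n
    using that
  proof (induction n arbitrary: v)
    case 0
    then show ?case using desc_unique[of v v x] by auto
  next
    case (Suc n)
    then have p: "desc (parent v) x" using desc_cases[of v x] by auto
    then have "up v \<in> F" using no[of v "up v"] Suc.prems by (auto simp: bd_def up_in_subtree)
    then show ?case using up_verts[of v F] Suc.IH[of "parent v"] Suc.prems p by simp
  qed
  moreover obtain v where v: "e = up v" by (rule edge_cases)
  have "parent v \<in> verts F" "desc (parent v) x"
    using assms up_verts unfolding v by (auto simp: up_in_subtree)
  ultimately have "x \<in> verts F" using desc_level le_Suc_ex by metis
  then show False using subtree_closed no assms(3) by blast
qed

text \<open>Subtrees rooted at one level are edge-disjoint, so the pairs supplied by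
  \<open>bd_in_subtree\<close> are distinct.\<close>

lemma card_bd_ge:
  assumes "finite F" and "\<And>w. w \<in> W \<Longrightarrow> level w = l"
    and "\<And>w. w \<in> W \<Longrightarrow> \<exists>e\<in>F. e \<in> complete_subtree w"
    and "\<And>w. w \<in> W \<Longrightarrow> \<not> complete_subtree w \<subseteq> F"
  shows "card W \<le> card (bd F)"
proof -
  have "\<forall>w\<in>W. \<exists>p\<in>bd F. snd p \<in> complete_subtree w" using assms(3,4) bd_in_subtree by meson
  then obtain g where g: "\<And>w. w \<in> W \<Longrightarrow> g w \<in> bd F \<and> snd (g w) \<in> complete_subtree w"
    by metis
  have "inj_on g W" by (rule inj_onI) (metis g assms(2) subtree_disjoint)
  then show ?thesis using g finite_bd[OF assms(1)] by (intro card_inj_on_le[of g]) auto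
qed

section \<open>The height\<close>

lemma lambda_ge:
  assumes "finite F" "complete_subtree x \<subseteq> F"
  shows "level x \<le> lambda_height F"
  unfolding lambda_height_def using assms by (intro Max_ge finite_heights) blast+

lemma lambda_attained:
  assumes "finite F"
  shows "lambda_height F = 0 \<or> (\<exists>x. level x = lambda_height F \<and> complete_subtree x \<subseteq> F)"
proof -
  have "lambda_height F \<in> {k. k = 0 \<or> (\<exists>x. level x = k \<and> complete_subtree x \<subseteq> F)}"
    unfolding lambda_height_def by (rule Max_in[OF finite_heights[OF assms]]) auto
  then show ?thesis by blast
qed

text \<open>Thirty times the lower bound of the theorem, by \<open>\<Delta>_eq_bd\<close>. Being an
  integer, it gains 1 from every strict inequality.\<close>

definition val :: "edge set \<Rightarrow> nat" where
  "val F = lambda_height F + 4 * card (bd F)"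

text \<open>
  Passing to the children of the vertices in \<open>W\<close> doubles the boundary and costs one level, so the
  bound only improves until some subtree of the next lower level lies in \<open>F\<^sub>1\<close> or in \<open>F\<^sub>2\<close>.
\<close>

lemma val_split:
  assumes fin: "finite F\<^sub>1" "finite F\<^sub>2"
    and "finite W" "W \<noteq> {}" "\<And>w. w \<in> W \<Longrightarrow> level w = Suc l"
    and "\<And>w. w \<in> W \<Longrightarrow> complete_subtree w \<subseteq> F\<^sub>1 \<union> F\<^sub>2"
    and "\<And>w. w \<in> W \<Longrightarrow> \<not> complete_subtree w \<subseteq> F\<^sub>1 \<and> \<not> complete_subtree w \<subseteq> F\<^sub>2"
  shows "l + 4 * card W \<le> val F\<^sub>1 \<or> l + 4 * card W \<le> val F\<^sub>2"
  using assms(3-)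
proof (induction l arbitrary: W)
  case (0 W)
  \<comment> \<open>Covered by the union but not by \<open>F\<^sub>2\<close>, each subtree meets
    \<open>F\<^sub>1\<close>.\<close>
  have "card W \<le> card (bd F\<^sub>1)"
  proof (rule card_bd_ge[OF fin(1) 0(3)])
    show "\<exists>e\<in>F\<^sub>1. e \<in> complete_subtree w" if "w \<in> W" for w using 0(4,5)[OF that] by blast
    show "\<not> complete_subtree w \<subseteq> F\<^sub>1" if "w \<in> W" for w using 0(5)[OF that] by blast
  qed
  then show ?case by (simp add: val_def)
next
  case (Suc l W)
  show ?case
  proof (cases "Suc l \<le> lambda_height F\<^sub>1 \<or> Suc l \<le> lambda_height F\<^sub>2")
    case True
    \<comment> \<open>Both boundaries are estimated, since either set may be the one of height at
      least \<open>Suc l\<close>.\<close>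
    have some: "(\<exists>e\<in>F\<^sub>1. e \<in> complete_subtree w) \<and> (\<exists>e\<in>F\<^sub>2. e \<in> complete_subtree w)" if "w \<in> W" for w
      using Suc.prems(4,5)[OF that] by blast
    have "card W \<le> card (bd F\<^sub>1)"
      by (rule card_bd_ge[OF fin(1) Suc.prems(3)]) (simp_all add: some Suc.prems(5))
    moreover have "card W \<le> card (bd F\<^sub>2)"
      by (rule card_bd_ge[OF fin(2) Suc.prems(3)]) (simp_all add: some Suc.prems(5))
    ultimately have "card W \<le> card (bd F\<^sub>1)" "card W \<le> card (bd F\<^sub>2)" .
    then show ?thesis using True unfolding val_def by linarith
  next
    case False
    \<comment> \<open>The values at \<open>(w, 0)\<close> and \<open>(w, 1)\<close> are the two
      children of \<open>w\<close>.\<close>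
    define g where "g = (\<lambda>(w::vertex, i). (Suc l, 2 * snd w + i))"
    define W' where "W' = g ` (W \<times> {0, 1})"
    have lev: "fst w = Suc (Suc l)" if "w \<in> W" for w using Suc.prems(3)[OF that] by (simp add: level_def)
    have "inj_on g (W \<times> {0, 1})"
    proof (rule inj_onI)
      fix p p' assume p: "p \<in> W \<times> {0, 1}" "p' \<in> W \<times> {0, 1}" "g p = g p'"
      obtain w i w' i' where w: "p = (w, i)" "p' = (w', i')" by (cases p, cases p')
      have W: "w \<in> W" "w' \<in> W" and i: "i < 2" "i' < 2" using p w by auto
      have *: "2 * snd w + i = 2 * snd w' + i'" using p(3) by (simp add: w g_def)
      then have "i = i'" using i by presburger
      then show "p = p'" using * lev[OF W(1)] lev[OF W(2)] by (simp add: w prod_eq_iff)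
    qed
    then have card: "card W' = 2 * card W"
      unfolding W'_def by (simp add: card_image card_cartesian_product)
    have par: "parent v \<in> W" "level v = Suc l" if "v \<in> W'" for v
    proof -
      obtain w i where v: "w \<in> W" "i \<in> {0, 1::nat}" "v = g (w, i)" using \<open>v \<in> W'\<close> unfolding W'_def by blast
      then have "parent v = w" using lev[OF v(1)] by (auto simp: g_def parent_def prod_eq_iff)
      then show "parent v \<in> W" "level v = Suc l" using v by (auto simp: g_def level_def)
    qed
    have no: "\<not> complete_subtree v \<subseteq> F\<^sub>1 \<and> \<not> complete_subtree v \<subseteq> F\<^sub>2" if "v \<in> W'" for v
      using lambda_ge[OF fin(1), of v] lambda_ge[OF fin(2), of v] par(2)[OF that] False by auto
    have sub: "complete_subtree v \<subseteq> F\<^sub>1 \<union> F\<^sub>2" if "v \<in> W'" for v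
      using Suc.prems(4)[OF par(1)[OF that]] subtree_mono[OF desc_parent_self[of v]] by blast
    \<comment> \<open>Doubling the number of subtrees gains \<open>4 * card W\<close>, which pays
      for the lost level.\<close>
    have "l + 4 * card W' \<le> val F\<^sub>1 \<or> l + 4 * card W' \<le> val F\<^sub>2"
      by (rule Suc.IH) (use Suc.prems(1,2) no sub par in \<open>auto simp: W'_def\<close>)
    moreover have "1 \<le> card W" using Suc.prems(1,2) by (simp add: Suc_le_eq card_gt_0_iff)
    ultimately show ?thesis using card by linarith
  qed
qed

text \<open>
  Every edge of the path from \<open>w\<close> to its ancestor has a sibling tree attached; either this tree is
  contained in \<open>F\<close>, which raises the height, or it contributes to the boundary.
\<close>

lemma bd_path:
  assumes "finite F" "complete_subtree w \<subseteq> F" "\<And>j. j < h \<Longrightarrow> up ((parent ^^ j) w) \<in> F"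
  shows "\<exists>i u C. i \<le> h \<and> complete_subtree u \<subseteq> F \<and> desc u ((parent ^^ h) w) \<and> level w + i \<le> level u
    \<and> (i = h \<longrightarrow> u = (parent ^^ h) w) \<and> C \<subseteq> bd F \<and> snd ` C \<subseteq> complete_subtree ((parent ^^ h) w)
    \<and> h \<le> i + card C"
  using assms(3)
proof (induction h)
  case 0
  show ?case by (rule exI[of _ 0], rule exI[of _ w], rule exI[of _ "{}"]) (use assms(2) in simp)
next
  case (Suc h)
  define v where "v = (parent ^^ h) w"
  have pv: "(parent ^^ Suc h) w = parent v" by (simp add: v_def)
  obtain i u C where IH: "i \<le> h" "complete_subtree u \<subseteq> F" "desc u v" "level w + i \<le> level u"
    "i = h \<longrightarrow> u = v" "C \<subseteq> bd F" "snd ` C \<subseteq> complete_subtree v" "h \<le> i + card C"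
    using Suc unfolding v_def by auto
  have v: "up v \<in> F" using Suc.prems[of h] by (simp add: v_def)
  have lv: "level v = level w + h" by (simp add: v_def)
  have sub: "complete_subtree v \<subseteq> complete_subtree (parent v)" by (simp add: subtree_mono)
  let ?X = "insert (up (sib v)) (complete_subtree (sib v))"
  show ?case
  proof (cases "?X \<subseteq> F")
    case True
    show ?thesis
    proof (cases "i = h")
      \<comment> \<open>Here \<open>u = v\<close>, so the whole tree below \<open>parent v\<close>
        lies in \<open>F\<close> and \<open>u\<close> moves up.\<close>
      case i: True
      then have "complete_subtree (parent v) \<subseteq> F"
        using True v IH(2,5) unfolding subtree_parent[of v] by auto
      then show ?thesis unfolding pv using i IH(6-8) lv sub
        by (intro exI[of _ "Suc i"] exI[of _ "parent v"] exI[of _ C]) auto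
    next
      \<comment> \<open>The sibling tree replaces \<open>u\<close>: its level
        \<open>level w + h\<close> suffices because \<open>i < h\<close>.\<close>
      case False
      then show ?thesis unfolding pv using True IH(1,6-8) lv sub
        by (intro exI[of _ "Suc i"] exI[of _ "sib v"] exI[of _ C]) (auto simp: desc_parent_iff)
    qed
  next
    case False
    have "\<exists>p\<in>bd F. snd p \<in> ?X"
    proof (cases "up (sib v) \<in> F")
      case True
      have "\<not> complete_subtree (sib v) \<subseteq> F" using False True by blast
      then obtain a e where "(a, e) \<in> bd F" "e \<in> complete_subtree (sib v)"
        using subtree_closed[of "sib v" F] up_verts[OF True] by blast
      then show ?thesis by force
    next
      case no: False
      then have "(parent v, up (sib v)) \<in> bd F" using up_verts[OF v] by (auto simp: bd_def)
      then show ?thesis by force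
    qed
    then obtain p where p: "p \<in> bd F" "snd p \<in> ?X" by blast
    \<comment> \<open>The edges of pairs in \<open>C\<close> lie below \<open>v\<close>, hence
      outside \<open>?X\<close>, so \<open>p\<close> is new.\<close>
    have "snd p \<notin> complete_subtree v"
    proof
      assume q: "snd p \<in> complete_subtree v"
      show False
      proof (cases "snd p = up (sib v)")
        case True
        then show False using q desc_level[of "parent v" v] by (auto simp: up_in_subtree)
      next
        case False
        then show False using p(2) q subtree_disjoint[of "snd p" v "sib v"] sib_neq[of v] by auto
      qed
    qed
    then have "p \<notin> C" using IH(7) by auto
    moreover have "finite C" using IH(6) finite_bd[OF assms(1)] finite_subset by blast
    ultimately have "card (insert p C) = Suc (card C)" by simp
    then show ?thesis unfolding pv using IH p lv sub
      by (intro exI[of _ i] exI[of _ u] exI[of _ "insert p C"])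
        (auto simp: desc_parent_iff subtree_parent[of v])
  qed
qed

section \<open>Removing components\<close>

lemma graph_ominus_subset: "graph_ominus F S \<subseteq> F"
  by (auto simp: graph_ominus_def components_def component_of_def)

lemma graph_ominus_empty: "graph_ominus F {} = F"
proof
  show "F \<subseteq> graph_ominus F {}"
  proof
    fix e assume e: "e \<in> F"
    obtain v where v: "e = up v" by (rule edge_cases)
    have "e \<in> component_of F v" "v \<in> verts F" using e up_verts by (auto simp: component_of_def v)
    then show "e \<in> graph_ominus F {}" by (auto simp: graph_ominus_def components_def)
  qed
qed (rule graph_ominus_subset)

lemma graph_restrict: "graph (restrict_labels K A) = graph A \<inter> K"
proof (induction A)
  case (Atom l)
  then show ?case by (cases l) auto
qed auto

lemma graph_jominus: "graph (A \<ominus>\<^sub>J S) = graph_ominus (graph A) S"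
  using graph_ominus_subset by (auto simp: jominus_def graph_restrict)

text \<open>Since \<open>up y\<close> is missing, no path in \<open>F\<close> leaves the part below
  \<open>y\<close>, so components starting there avoid \<open>S\<close>.\<close>

lemma subtree_ominus:
  assumes x: "complete_subtree x \<subseteq> F" and xy: "desc x y" and y: "up y \<notin> F"
    and S: "\<And>v. v \<in> S \<Longrightarrow> \<not> desc v y"
  shows "complete_subtree x \<subseteq> graph_ominus F S"
proof
  let ?R = "{(a, b). \<exists>d\<in>F. endpoints d = {a, b}}"
  have step: "desc b y" if ab: "(a, b) \<in> ?R" "desc a y" for a b
  proof -
    obtain d where d: "d \<in> F" "endpoints d = {a, b}" using ab(1) by blast
    obtain u where u: "d = up u" by (rule edge_cases)
    have "u \<noteq> y" using d u y by auto
    then show ?thesis using d(2) ab(2) desc_cases[of u y] desc_parent[of u y]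
      unfolding u endpoints_up doubleton_eq_iff by auto
  qed
  have conn: "desc b y" if "(a, b) \<in> ?R\<^sup>*" "desc a y" for a b
    using that by (induction rule: rtrancl_induct) (use step in blast)+
  fix e assume e: "e \<in> complete_subtree x"
  obtain v where v: "e = up v" by (rule edge_cases)
  have eF: "e \<in> F" using e x by blast
  have vy: "desc v y" using e xy desc_parent desc_trans unfolding v up_in_subtree by blast
  have "desc b y" if b: "b \<in> verts (component_of F v)" for b
  proof -
    obtain d a where d: "d \<in> F" "b \<in> endpoints d" "a \<in> endpoints d" "(v, a) \<in> ?R\<^sup>*"
      using b unfolding verts_def component_of_def by blast
    have a: "desc a y" using conn[OF d(4) vy] .
    show ?thesis
    proof (cases "a = b")
      case False
      obtain u where "d = up u" by (rule edge_cases)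
      then have "endpoints d = {a, b}" using d(2,3) False by auto
      then show ?thesis using step[of a b] a d(1) by blast
    qed (use a in simp)
  qed
  then have "verts (component_of F v) \<inter> S = {}" using S by blast
  moreover have "e \<in> component_of F v" "v \<in> verts F" using eF up_verts by (auto simp: component_of_def v)
  ultimately show "e \<in> graph_ominus F S" by (auto simp: graph_ominus_def components_def)
qed

section \<open>The potential\<close>

lemma sub_join_tree_refl [simp]: "A \<preceq>\<^sub>J A"
  by (cases A) auto

lemma sub_join_tree_trans: "Join B C \<preceq>\<^sub>J A \<Longrightarrow> D \<preceq>\<^sub>J B \<or> D \<preceq>\<^sub>J C \<Longrightarrow> D \<preceq>\<^sub>J A"
  by (induction A) auto

lemma strict_child:
  assumes "Join B C \<preceq>\<^sub>J A"
  shows "B \<prec>\<^sub>J A" "C \<prec>\<^sub>J A"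
  using sub_join_tree_trans[OF assms, of B] sub_join_tree_trans[OF assms, of C] leaves_sub[OF assms]
    leaves_pos[of B] leaves_pos[of C] by (auto simp: strict_sub_join_tree_def)

lemma leaves_strict:
  assumes "D \<prec>\<^sub>J Join B C"
  shows "leaves D < leaves (Join B C)"
  using assms leaves_pos[of B] leaves_pos[of C] leaves_sub[of D B] leaves_sub[of D C]
  unfolding strict_sub_join_tree_def by auto

text \<open>Descend through children satisfying \<open>P\<close> for as long as possible.\<close>

lemma sub_join_tree_last:
  assumes "P A" "\<And>l. \<not> P (Atom l)"
  shows "\<exists>B C. Join B C \<preceq>\<^sub>J A \<and> P (Join B C) \<and> \<not> P B \<and> \<not> P C"
  using assms(1)
proof (induction A)
  case (Join B C)
  then show ?case by (cases "P B"; cases "P C") auto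
qed (use assms(2) in blast)

lemma j\<Delta>_nonneg: "0 \<le> j\<Delta> A"
  by (simp add: j\<Delta>_def \<Delta>_nonneg finite_graph)

lemma \<Phi>_nonneg: "0 \<le> \<Phi> A"
  using admissible_\<Phi> by (simp add: admissible_def)

lemma \<Phi>_child: "\<Phi> B \<le> \<Phi> (Join B C)" "\<Phi> B \<le> \<Phi> (Join C B)"
proof -
  have d: "dagger \<Phi>" using admissible_\<Phi> by (simp add: admissible_def)
  have "\<Phi> D \<le> \<Phi> A" if "A \<in> {Join D E, Join E D}" for A D E :: "edge join_tree"
    using d[unfolded dagger_def, rule_format, of A D E D] that j\<Delta>_nonneg[of "E \<ominus>\<^sub>J jverts D"]
      j\<Delta>_nonneg[of "A \<ominus>\<^sub>J (jverts E \<union> jverts D)"] by simp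
  then show "\<Phi> B \<le> \<Phi> (Join B C)" "\<Phi> B \<le> \<Phi> (Join C B)" by auto
qed

text \<open>The unlabelled atom precedes every \<open>A\<close> by convention without being reached
  through children, hence the separate disjunct.\<close>

lemma \<Phi>_mono: "D \<preceq>\<^sub>J A \<Longrightarrow> D = Atom None \<or> \<Phi> D \<le> \<Phi> A"
proof (induction A)
  case (Join B C)
  then show ?case using \<Phi>_child(1)[of B C] \<Phi>_child(2)[of C B] by auto
qed auto

lemma \<Phi>_ddagger:
  "D \<prec>\<^sub>J A \<Longrightarrow> E \<prec>\<^sub>J A \<Longrightarrow> \<Phi> A \<ge> 1 / 2 * (\<Phi> D + \<Phi> (E \<ominus>\<^sub>J jverts D) + j\<Delta> A + j\<Delta> (A \<ominus>\<^sub>J (jverts D \<union> jverts E)))"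
  using admissible_\<Phi> unfolding admissible_def ddagger_def by blast

text \<open>Take both subtrees in \<open>ddagger\<close> to be the unlabelled atom: nothing is
  removed, so \<open>j\<Delta> A\<close> occurs twice.\<close>

lemma \<Phi>_ge_\<Delta>: "\<Phi> A \<ge> j\<Delta> A"
proof (cases "A = Atom None")
  case True
  then show ?thesis using \<Phi>_nonneg[of A] by (simp add: j\<Delta>_def \<Delta>_def verts_def)
next
  case False
  have "Atom None \<preceq>\<^sub>J A" by (cases A) auto
  then have s: "Atom None \<prec>\<^sub>J A" using False by (simp add: strict_sub_join_tree_def)
  have "jverts (Atom None) = {}" by (simp add: jverts_def verts_def)
  then have "j\<Delta> (A \<ominus>\<^sub>J (jverts (Atom None) \<union> jverts (Atom None))) = j\<Delta> A"
    by (simp add: j\<Delta>_def graph_jominus graph_ominus_empty)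
  then show ?thesis
    using \<Phi>_ddagger[OF s s] \<Phi>_nonneg[of "Atom None"] \<Phi>_nonneg[of "Atom None \<ominus>\<^sub>J jverts (Atom None)"] by argo
qed

text \<open>Two sibling edges lie below \<open>w\<close>, while an atom carries at most one
  edge.\<close>

lemma subtree_not_atom:
  assumes "1 \<le> level w"
  shows "\<not> complete_subtree w \<subseteq> graph (Atom l)"
proof
  assume s: "complete_subtree w \<subseteq> graph (Atom l)"
  obtain y where y: "parent y = w" using exists_child[OF assms] .
  then have "up y \<in> complete_subtree w" "up (sib y) \<in> complete_subtree w" by (simp_all add: up_in_subtree)
  then have "up y \<in> graph (Atom l)" "up (sib y) \<in> graph (Atom l)" using s by blast+
  then have "up y = up (sib y)" by (cases l) (simp_all del: up_inject)
  then show False using sib_neq[of y] up_inject[of y "sib y"] by simp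
qed

lemma card_bd_pos:
  assumes "finite F" "complete_subtree w \<subseteq> F" "1 \<le> level w"
  shows "1 \<le> card (bd F)"
proof -
  obtain y where y: "parent y = w" using exists_child[OF assms(3)] .
  then have "up y \<in> F" using assms(2) by (auto simp: up_in_subtree)
  then obtain v where "(v, up v) \<in> bd F" using bd_top[OF assms(1)] by blast
  then show ?thesis using finite_bd[OF assms(1)] by (metis card_gt_0_iff empty_iff Suc_leI One_nat_def)
qed

section \<open>Numerical parameters\<close>

lemma linear_le_power: "32 * n \<le> 2 ^ n + (128::nat)" "16 * n \<le> 2 ^ n + (48::nat)"
proof -
  \<comment> \<open>From exponent 5 on, each doubling adds at least 32 on the right.\<close>
  have *: "32 * (m + 5) \<le> 2 ^ (m + 5) + (128::nat)" "16 * (m + 5) \<le> 2 ^ (m + 5) + (48::nat)" for m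
    by (induction m) (simp_all add: power_add)
  have "32 * n \<le> 2 ^ n + (128::nat) \<and> 16 * n \<le> 2 ^ n + (48::nat)"
  proof (cases "n < 5")
    case True
    then have "n = 0 \<or> n = 1 \<or> n = 2 \<or> n = 3 \<or> n = 4" by linarith
    then show ?thesis by (elim disjE) simp_all
  next
    case False
    then obtain m where "n = m + 5" by (metis add.commute le_Suc_ex not_less)
    then show ?thesis using * by blast
  qed
  then show "32 * n \<le> 2 ^ n + (128::nat)" "16 * n \<le> 2 ^ n + (48::nat)" by blast+
qed

lemma power_bracket:
  assumes "1 \<le> (m::nat)"
  obtains n where "2 ^ n \<le> m" "m < 2 ^ Suc n"
  using assms ex_power_ivl1[of 2 m] by auto

text \<open>The second condition yields \<open>D\<close>, the third the contradiction from
  \<open>ddagger\<close>, the fourth makes \<open>q\<close> positive, and the last settles the case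
  of a path inside \<open>E\<close>.\<close>

lemma parameters_exist:
  assumes b: "1 \<le> (b::nat)"
  obtains a h where "1 \<le> a" "2 * b + a div 4 + (a - 1) div 4 < 2 ^ a" "h + 2 * a \<le> 2 * b + 8"
    "a + h \<le> 6 * b" "1 \<le> h" "\<And>i. 3 * h + 5 \<le> 4 * b + a + 3 * i \<Longrightarrow> 4 * b + a + h < 4 * 2 ^ i"
proof -
  \<comment> \<open>The bound on \<open>3 * c\<close> forces \<open>c \<le> i\<close> for every
    \<open>i\<close> satisfying the premise, so the exponential bound is checked at \<open>c\<close>
    only.\<close>
  have "\<exists>a h c. 1 \<le> a \<and> 2 * b + a div 4 + (a - 1) div 4 < 2 ^ a \<and> h + 2 * a \<le> 2 * b + 8 \<and>
    a + h \<le> 6 * b \<and> 1 \<le> h \<and> 4 * b + a + 3 * c < 3 * h + 8 \<and> 4 * b + a + h < 4 * 2 ^ c"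
    (is "\<exists>a h c. ?P b a h c")
  proof (cases "b < 16")
    case True
    have "?P 1 2 2 2" "?P 2 3 4 2" "?P 3 3 6 3" "?P 4 4 8 3" "?P 5 4 10 4" "?P 6 4 12 4" "?P 7 4 14 4"
      "?P 8 5 14 4" "?P 9 5 16 4" "?P 10 5 18 5" "?P 11 5 20 5" "?P 12 5 22 5" "?P 13 5 24 5"
      "?P 14 5 26 5" "?P 15 6 26 5"
      by simp_all
    moreover have "b \<in> {1, 2, 3, 4, 5, 6, 7, 8, 9, 10, 11, 12, 13, 14, 15}" using b True by simp presburger
    ultimately show ?thesis by blast
  next
    case False
    \<comment> \<open>With \<open>a = Suc a'\<close>, \<open>c = Suc c'\<close> and \<open>h\<close>
      as large as the third condition permits, \<open>7 * a + 3 * c < 2 * b + 32\<close> is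
      required. The estimates \<open>l\<close> bound the left side by 33b/32 + 47, which is enough
      from \<open>b = 16\<close> on.\<close>
    obtain a' where a': "2 ^ a' \<le> 3 * b" "3 * b < 2 ^ Suc a'" using power_bracket[of "3 * b"] b by auto
    obtain c' where c': "2 ^ c' \<le> 2 * b" "2 * b < 2 ^ Suc c'" using power_bracket[of "2 * b"] b by auto
    have l: "32 * a' \<le> 3 * b + 128" "16 * c' \<le> 2 * b + 48"
      using linear_le_power(1)[of a'] linear_le_power(2)[of c'] a'(1) c'(1) by linarith+
    show ?thesis
      by (rule exI[of _ "Suc a'"], rule exI[of _ "2 * b + 8 - 2 * Suc a'"], rule exI[of _ "Suc c'"])
        (use a' c' l False in \<open>auto; linarith\<close>)
  qed
  then obtain a h c where P: "?P b a h c" by blast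
  moreover have "4 * b + a + h < 4 * 2 ^ i" if "3 * h + 5 \<le> 4 * b + a + 3 * i" for i
  proof -
    have "c \<le> i" using that P by linarith
    then have "2 ^ c \<le> (2 ^ i :: nat)" by simp
    then show ?thesis using P by linarith
  qed
  ultimately show ?thesis using that by blast
qed

section \<open>Induction on the number of leaves\<close>

lemma val_le_\<Phi>: "real (val (graph A)) \<le> 30 * \<Phi> A"
proof (induction A rule: measure_induct_rule[of leaves])
  case (less A)
  let ?G = "graph A"
  define k b where "k = lambda_height ?G" and "b = card (bd ?G)"
  note fin = finite_graph
  have bj: "j\<Delta> X = real (card (bd (graph X))) / 3" for X by (simp add: j\<Delta>_def \<Delta>_eq_bd fin)
  show ?case
  proof (rule ccontr)
    assume "\<not> ?case"
    then have small: "30 * \<Phi> A < real (k + 4 * b)" by (simp add: val_def k_def b_def)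
    then have kb: "6 * b < k" using \<Phi>_ge_\<Delta>[of A] bj[of A] by (simp add: b_def)
    then obtain x where x: "level x = k" "complete_subtree x \<subseteq> ?G"
      using lambda_attained[OF fin, of A] unfolding k_def by auto
    have b: "1 \<le> b" using card_bd_pos[OF fin x(2)] x(1) kb by (simp add: b_def)
    obtain A\<^sub>1 A\<^sub>2 where A: "A = Join A\<^sub>1 A\<^sub>2"
      using subtree_not_atom[of x] x kb by (cases A) auto
    have R0: "val (graph D) < k + 4 * b" if "D \<prec>\<^sub>J A" for D
    proof (cases "D = Atom None")
      case True
      have "val (graph D) = 0" using lambda_attained[OF fin, of D] subtree_not_atom[of _ None]
        by (force simp: True val_def bd_def verts_def)
      then show ?thesis using b by simp
    next
      case False
      have "real (val (graph D)) \<le> 30 * \<Phi> D" using leaves_strict[of D A\<^sub>1 A\<^sub>2] that unfolding A by (intro less[unfolded A]) simp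
      also have "\<Phi> D \<le> \<Phi> A" using \<Phi>_mono[of D A] that False by (simp add: strict_sub_join_tree_def)
      finally show ?thesis using small by linarith
    qed
    obtain a h where par: "1 \<le> a" "2 * b + a div 4 + (a - 1) div 4 < 2 ^ a"
      "h + 2 * a \<le> 2 * b + 8" "a + h \<le> 6 * b" "1 \<le> h"
      "\<And>i. 3 * h + 5 \<le> 4 * b + a + 3 * i \<Longrightarrow> 4 * b + a + h < 4 * 2 ^ i"
      using parameters_exist[OF b] by metis
    define l q where "l = k - a" and "q = k - a - h"
    have lq: "k = l + a" "l = q + h" "1 \<le> q" "1 \<le> l" using par(4) kb by (auto simp: l_def q_def)
    define n where "n = (\<lambda>F. card {w \<in> descs x l. complete_subtree w \<subseteq> F})"
    have finx: "finite (descs x l)" and cardx: "card (descs x l) = 2 ^ a"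
      using finite_descs[of l x] card_descs[of l x] x(1) lq by simp_all
    \<comment> \<open>The largest boundary that \<open>R0\<close> allows for a strict subtree of
      height at least \<open>l\<close>.\<close>
    define t where "t = b + (a - 1) div 4"
    \<comment> \<open>The level lost in \<open>val_split\<close> is regained from the strictness in
      \<open>R0\<close>.\<close>
    have split: "4 * card W + l' \<le> k + 4 * b"
      if "Join B C \<preceq>\<^sub>J A" "finite W" "W \<noteq> {}" "\<And>w. w \<in> W \<Longrightarrow> level w = l'" "1 \<le> l'"
        "\<And>w. w \<in> W \<Longrightarrow> complete_subtree w \<subseteq> graph (Join B C)"
        "\<And>w. w \<in> W \<Longrightarrow> \<not> complete_subtree w \<subseteq> graph B \<and> \<not> complete_subtree w \<subseteq> graph C" for B C W l'
    proof -
      have "l' - 1 + 4 * card W \<le> val (graph B) \<or> l' - 1 + 4 * card W \<le> val (graph C)"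
        using that by (intro val_split fin) auto
      then show ?thesis using R0[OF strict_child(1)] R0[OF strict_child(2)] that(1,5) by force
    qed

    \<comment> \<open>\<open>D\<close> is a child of a last join containing at least
      \<open>2 ^ a - t\<close> of the subtrees, so more than \<open>t\<close> of them are not
      contained in \<open>D\<close>.\<close>
    obtain D where D: "D \<prec>\<^sub>J A" "1 \<le> n (graph D)" "n (graph D) + t < 2 ^ a"
    proof -
      have P: "2 ^ a \<le> n ?G + t"
      proof -
        have "{w \<in> descs x l. complete_subtree w \<subseteq> ?G} = descs x l"
          using x(2) subtree_mono by (fastforce simp: descs_def)
        then show ?thesis using cardx by (simp add: n_def)
      qed
      have "\<not> 2 ^ a \<le> n (graph (Atom s :: edge join_tree)) + t" for s
      proof -
        have "{w \<in> descs x l. complete_subtree w \<subseteq> graph (Atom s :: edge join_tree)} = {}"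
          using subtree_not_atom[of _ s] lq by (auto simp: descs_def)
        then have "n (graph (Atom s :: edge join_tree)) = 0" unfolding n_def by (metis (no_types, lifting) card.empty)
        then show ?thesis using par(2) unfolding t_def by linarith
      qed
      then obtain B C where BC: "Join B C \<preceq>\<^sub>J A" "2 ^ a \<le> n (graph (Join B C)) + t"
        "n (graph B) + t < 2 ^ a" "n (graph C) + t < 2 ^ a"
        using sub_join_tree_last[of "\<lambda>F. 2 ^ a \<le> n (graph F) + t" A] P by (auto simp: not_le)
      have "1 \<le> n (graph B) \<or> 1 \<le> n (graph C)"
      proof (rule ccontr)
        assume no: "\<not> ?thesis"
        let ?W = "{w \<in> descs x l. complete_subtree w \<subseteq> graph (Join B C)}"
        have big: "b + a div 4 < card ?W" using BC(2) par(2) unfolding n_def t_def by linarith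
        have no: "{w \<in> descs x l. complete_subtree w \<subseteq> graph B} = {}"
          "{w \<in> descs x l. complete_subtree w \<subseteq> graph C} = {}"
          using no finx unfolding n_def by (simp_all add: Suc_le_eq card_gt_0_iff)
        \<comment> \<open>Otherwise every subtree counted for the join is divided between its
          children, which is too many for \<open>split\<close>.\<close>
        have "4 * card ?W + l \<le> k + 4 * b"
        proof (rule split[OF BC(1)])
          show "?W \<noteq> {}" using big by (metis card.empty not_less_zero)
          show "finite ?W" using finx by simp
        qed (use no lq in \<open>auto simp: descs_def\<close>)
        then show False using big lq by linarith
      qed
      then show ?thesis using that strict_child[OF BC(1)] BC(3,4) by blast
    qed
    have "{w \<in> descs x l. complete_subtree w \<subseteq> graph D} \<noteq> {}"
      using D(2) unfolding n_def by (metis card.empty not_one_le_zero)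
    then obtain d where d: "level d = l" "complete_subtree d \<subseteq> graph D" by (auto simp: descs_def)
    have lD: "l \<le> lambda_height (graph D)" using lambda_ge[OF fin d(2)] d(1) by simp
    have bD: "1 \<le> card (bd (graph D))" using card_bd_pos[OF fin d(2)] d(1) lq by simp
    have "card (bd (graph D)) \<le> t"
      using R0[OF D(1)] lD lq par(1) unfolding val_def t_def by linarith
    \<comment> \<open>Otherwise the more than \<open>t\<close> subtrees not contained in
      \<open>D\<close> would each add a boundary pair to it.\<close>
    obtain z where z: "level z = l" "desc z x" "complete_subtree z \<inter> graph D = {}"
    proof (rule ccontr)
      assume no: "\<not> thesis"
      have meets: "\<exists>e\<in>graph D. e \<in> complete_subtree w" if "w \<in> descs x l" for w
        using no that \<open>\<And>z. level z = l \<Longrightarrow> desc z x \<Longrightarrow> complete_subtree z \<inter> graph D = {} \<Longrightarrow> thesis\<close>[of w]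
        by (auto simp: descs_def)
      let ?W = "{w \<in> descs x l. complete_subtree w \<subseteq> graph D}"
      have "card (descs x l - ?W) \<le> card (bd (graph D))"
      proof (rule card_bd_ge[OF fin])
        show "level w = l" if "w \<in> descs x l - ?W" for w using that by (simp add: descs_def)
      qed (simp_all add: meets)
      moreover have "card (descs x l - ?W) = 2 ^ a - n (graph D)"
        unfolding n_def cardx[symmetric] using finx by (intro card_Diff_subset) auto
      ultimately show False using D(3) \<open>card (bd (graph D)) \<le> t\<close> by linarith
    qed
    \<comment> \<open>\<open>z\<close> itself may be a vertex of \<open>D\<close> through its parent
      edge, so \<open>y\<close> has to lie strictly below \<open>z\<close>.\<close>
    have Dz: "\<not> desc v y" if vD: "v \<in> jverts D" and yz: "desc y z" "level y < level z" for v y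
    proof
      assume vy: "desc v y"
      obtain e where e: "e \<in> graph D" "v \<in> endpoints e"
        using vD unfolding jverts_def verts_def by blast
      obtain u where u: "e = up u" by (rule edge_cases)
      have "desc v z" using desc_trans vy yz(1) by blast
      moreover have "v \<noteq> z" using desc_level[OF vy] yz(2) by auto
      moreover have "v = u \<or> v = parent u" using e(2) by (simp add: u)
      ultimately have "desc (parent u) z" using desc_cases[of v z] by auto
      then have "e \<in> complete_subtree z" by (simp add: u up_in_subtree)
      then show False using e(1) z(3) by blast
    qed

    obtain B C w where BC: "Join B C \<preceq>\<^sub>J A" and w: "w \<in> descs z q" "complete_subtree w \<subseteq> graph (Join B C)"
      and no: "\<And>w. w \<in> descs z q \<Longrightarrow> \<not> complete_subtree w \<subseteq> graph B \<and> \<not> complete_subtree w \<subseteq> graph C"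
    proof -
      have "descs z q \<noteq> {}" using card_descs[of q z] z(1) lq by (metis card.empty le_add1 power_not_zero zero_neq_numeral)
      then have "\<exists>w\<in>descs z q. complete_subtree w \<subseteq> ?G"
        using x(2) subtree_mono desc_trans z(2) unfolding descs_def by blast
      moreover have "\<not> (\<exists>w\<in>descs z q. complete_subtree w \<subseteq> graph (Atom s :: edge join_tree))" for s
        using subtree_not_atom[of _ s] lq by (auto simp: descs_def)
      ultimately show ?thesis
        using sub_join_tree_last[of "\<lambda>F. \<exists>w\<in>descs z q. complete_subtree w \<subseteq> graph F" A] that by blast
    qed
    define E where "E = Join B C"
    have lw: "level w = q" and wz: "(parent ^^ h) w = z"
      using w(1) desc_funpow_level[of w z h] z(1) lq by (auto simp: descs_def)
    show False
    proof (cases "\<forall>j<h. up ((parent ^^ j) w) \<in> graph E")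
      case True
      obtain i u S where S: "i \<le> h" "complete_subtree u \<subseteq> graph E" "desc u z" "q + i \<le> level u"
        "S \<subseteq> bd (graph E)" "snd ` S \<subseteq> complete_subtree z" "h \<le> i + card S"
        using bd_path[OF fin, of w E h] w(2) True unfolding E_def[symmetric] wz lw by blast
      have "up ((parent ^^ (h - 1)) w) \<in> graph E" using True par(5) by simp
      moreover have "parent ((parent ^^ (h - 1)) w) = z" using par(5) wz by (cases h) simp_all
      ultimately have zE: "z \<in> verts (graph E)" "graph E \<noteq> {}" using up_verts by blast+
      \<comment> \<open>The parent edge of a topmost vertex of \<open>E\<close> is not below
        \<open>z\<close>, so it gives one boundary pair beyond \<open>S\<close>.\<close>
      obtain v where v: "(v, up v) \<in> bd (graph E)" "level z \<le> level v"
        using bd_top[OF fin zE(2)] zE(1) by metis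
      have "up v \<notin> complete_subtree z" using v(2) desc_level[of "parent v" z] by (auto simp: up_in_subtree)
      then have "(v, up v) \<notin> S" using S(6) by force
      moreover have "finite S" using S(5) finite_bd[OF fin] finite_subset by blast
      ultimately have "Suc (card S) \<le> card (bd (graph E))"
        using card_mono[OF finite_bd[OF fin], of "insert (v, up v) S" E] v(1) S(5) by simp
      then have bE: "h + 1 \<le> i + card (bd (graph E))" using S(7) by linarith
      have "3 * h + 5 \<le> 4 * b + a + 3 * i"
      proof (cases "E = A")
        case True
        then show ?thesis using bE S(1) par(1) by (simp add: b_def)
      next
        case False
        then have "E \<prec>\<^sub>J A" using BC by (simp add: E_def strict_sub_join_tree_def)
        then have "val (graph E) < k + 4 * b" by (rule R0)
        moreover have "q + i \<le> lambda_height (graph E)" using lambda_ge[OF fin S(2)] S(4) by linarith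
        ultimately show ?thesis using bE lq unfolding val_def by linarith
      qed
      then have "4 * b + a + h < 4 * 2 ^ i" by (rule par(6))
      \<comment> \<open>By the choice of the join, none of the at least \<open>2 ^ i\<close>
        subtrees of height \<open>q\<close> below \<open>u\<close> lies in \<open>B\<close> or in
        \<open>C\<close>.\<close>
      moreover have "4 * card (descs u q) + q \<le> k + 4 * b"
      proof (rule split[OF BC])
        have "descs u q \<subseteq> descs z q" using desc_trans[OF _ S(3)] by (auto simp: descs_def)
        then show "\<not> complete_subtree w' \<subseteq> graph B \<and> \<not> complete_subtree w' \<subseteq> graph C"
          if "w' \<in> descs u q" for w' using no that by blast
        show "descs u q \<noteq> {}" using card_descs[of q u] S(4)
          by (metis add_leD1 card.empty power_not_zero zero_neq_numeral)
        show "complete_subtree w' \<subseteq> graph (Join B C)" if "w' \<in> descs u q" for w'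
          using S(2) that subtree_mono unfolding E_def descs_def by blast
      qed (use S(4) lq finite_descs[of q u] in \<open>auto simp: descs_def\<close>)
      moreover have "2 ^ i \<le> card (descs u q)" using card_descs[of q u] S(4) by simp
      ultimately show False using lq by linarith
    next
      case False
      then obtain j where j: "j < h" "up ((parent ^^ j) w) \<notin> graph E" by blast
      let ?y = "(parent ^^ j) w"
      have "?y \<noteq> z" and ly: "level ?y < level z" using j(1) lw z(1) lq by auto
      have yz: "desc ?y z" unfolding wz[symmetric] desc_def using j(1)
        by (intro exI[of _ "h - j"]) (metis comp_apply funpow_add le_add_diff_inverse2 less_imp_le)
      \<comment> \<open>The missing path edge lies below \<open>x\<close>, so \<open>A\<close>
        contains it; \<open>ddagger\<close> requires a strict subtree.\<close>
      have EA: "E \<noteq> A"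
      proof
        assume "E = A"
        have "desc (parent ?y) x" using yz \<open>?y \<noteq> z\<close> desc_cases[of ?y z] z(2) desc_trans by blast
        then have "up ?y \<in> complete_subtree x" by (simp add: up_in_subtree)
        then show False using \<open>E = A\<close> j(2) x(2) by blast
      qed
      then have E: "E \<prec>\<^sub>J A" using BC by (simp add: E_def strict_sub_join_tree_def)
      let ?E = "E \<ominus>\<^sub>J jverts D"
      \<comment> \<open>The missing edge \<open>up ?y\<close> separates \<open>w\<close> from
        \<open>D\<close>, which has no vertex below \<open>?y\<close>.\<close>
      have wE: "complete_subtree w \<subseteq> graph ?E"
        unfolding graph_jominus using w(2) j(2) Dz[OF _ yz ly]
        by (intro subtree_ominus[of w _ ?y]) (auto simp: E_def)
      have "q + 4 \<le> val (graph ?E)"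
        using lambda_ge[OF fin wE] card_bd_pos[OF fin wE] lw lq unfolding val_def by linarith
      then have "real (q + 4) \<le> real (val (graph ?E))" by (rule of_nat_mono)
      \<comment> \<open>Relabelling preserves the number of leaves, so the induction hypothesis
        covers \<open>?E\<close>.\<close>
      also have "\<dots> \<le> 30 * \<Phi> ?E"
        using leaves_strict[of E A\<^sub>1 A\<^sub>2] E unfolding A by (intro less[unfolded A]) simp
      finally have \<Phi>E: "real (q + 4) \<le> 30 * \<Phi> ?E" .
      have "l + 4 \<le> val (graph D)" using lD bD unfolding val_def by linarith
      then have "real (l + 4) \<le> real (val (graph D))" by (rule of_nat_mono)
      also have "\<dots> \<le> 30 * \<Phi> D"
        using leaves_strict[of D A\<^sub>1 A\<^sub>2] D(1) unfolding A by (intro less[unfolded A]) simp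
      finally have "real (l + 4) \<le> 30 * \<Phi> D" .
      moreover have "j\<Delta> A = real b / 3" using bj by (simp add: b_def)
      ultimately have "real (q + 4) + real (l + 4) + 10 * real b \<le> 60 * \<Phi> A"
        using \<Phi>_ddagger[OF D(1) E] j\<Delta>_nonneg[of "A \<ominus>\<^sub>J (jverts D \<union> jverts E)"] \<Phi>E by argo
      \<comment> \<open>This amounts to \<open>2 * b + 8 < h + 2 * a\<close>, against the third
        condition on the parameters.\<close>
      then have "real (q + l + 8 + 10 * b) < real (2 * k + 8 * b)" using small by simp
      then show False using par(3) lq by linarith
    qed
  qed
qed

theorem theorem3p9:
  fixes A :: "edge join_tree"
  shows "\<Phi> A \<ge> 1 / 30 * real (lambda_height (graph A)) + 2 / 5 * \<Delta> (graph A)"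
  using val_le_\<Phi>[of A] by (simp add: val_def \<Delta>_eq_bd finite_graph)

end
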